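(* Let $R$ be a commutative ring and let $R=I_0\supseteq I_1\supseteq I_2\supseteq\dots\supseteq 0$ be a descending chain of ideals of $R$. Let $(K,w)$ be a weighted simplicial complex with weight function $w:K\to R$ such that all simplices of $K$ have nonzero weight. For $i\in\mathbb{Z}_{\geq 0}$ define $$L^i=K\setminus w^{-1}(I_i).$$ Then $$\emptyset=L^0\subseteq L^1\subseteq L^2\subseteq\dots\subseteq K\setminus w^{-1}(0)=K$$ is a filtration of $K$ (by simplicial subcomplexes).
   Context: Simplices are nonempty. A weighted simplicial complex (WSC) is a pair $(K,w)$ consisting of a simplicial complex $K$ and a function $w:K\to R$ ($R$ a commutative ring) assigning a weight to each simplex, such that for all $\sigma_1,\sigma_2\in K$ with $\sigma_1\subseteq\sigma_2$ one has $w(\sigma_1)\mid w(\sigma_2)$ in $R$. For an ideal $I$, $w^{-1}(I)=\{\sigma\in K: w(\sigma)\in I\}$; the notation $w^{-1}(0)$ means the preimage of the zero ideal. A filtration of $K$ is a nested increasing sequence of simplicial subcomplexes of $K$; the empty set counts as a subcomplex. *)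

theory Defs
  imports "HOL-Algebra.Ideal" "HOL-Algebra.Divisibility"
begin

text \<open>Abstract simplicial complexes, given by their set of simplices. The vertex set is
  \<open>\<Union>K\<close>; it need not be finite, and \<open>K = {}\<close> is allowed.\<close>

definition abstract_simplicial_complex :: "'v set set \<Rightarrow> bool" where
  "abstract_simplicial_complex K \<longleftrightarrow>
     (\<forall>\<sigma>\<in>K. finite \<sigma> \<and> \<sigma> \<noteq> {}) \<and>
     (\<forall>\<sigma>\<in>K. \<forall>\<tau>. \<tau> \<subseteq> \<sigma> \<and> \<tau> \<noteq> {} \<longrightarrow> \<tau> \<in> K)"

definition subcomplex :: "'v set set \<Rightarrow> 'v set set \<Rightarrow> bool" where
  "subcomplex L K \<longleftrightarrow> abstract_simplicial_complex L \<and> L \<subseteq> K"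

definition weighted_simplicial_complex ::
    "('r, 'm) ring_scheme \<Rightarrow> 'v set set \<Rightarrow> ('v set \<Rightarrow> 'r) \<Rightarrow> bool" where
  "weighted_simplicial_complex R K w \<longleftrightarrow>
     abstract_simplicial_complex K \<and>
     w \<in> K \<rightarrow> carrier R \<and>
     (\<forall>\<sigma>\<^sub>1\<in>K. \<forall>\<sigma>\<^sub>2\<in>K. \<sigma>\<^sub>1 \<subseteq> \<sigma>\<^sub>2 \<longrightarrow> w \<sigma>\<^sub>1 divides\<^bsub>R\<^esub> w \<sigma>\<^sub>2)"

text \<open>The preimage is taken in \<open>K\<close>: the values of \<open>w\<close> outside \<open>K\<close> are irrelevant.\<close>

definition weight_preimage :: "'v set set \<Rightarrow> ('v set \<Rightarrow> 'r) \<Rightarrow> 'r set \<Rightarrow> 'v set set" where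
  "weight_preimage K w I = {\<sigma> \<in> K. w \<sigma> \<in> I}"

text \<open>A filtration is not required to exhaust \<open>K\<close>.\<close>

definition filtration :: "'v set set \<Rightarrow> (nat \<Rightarrow> 'v set set) \<Rightarrow> bool" where
  "filtration K L \<longleftrightarrow> (\<forall>i. subcomplex (L i) K) \<and> (\<forall>i. L i \<subseteq> L (Suc i))"

end

theory Submission
  imports Defs
begin

text \<open>Divisibility provides a cofactor \<open>c\<close> in the carrier with
  \<open>b = a \<otimes> c\<close>, and the ideal absorbs right multiplication by
  \<open>c\<close>.\<close>

lemma (in ideal) divides_mem:
  assumes "a \<in> I" "a divides b"
  shows "b \<in> I"
  using assms by (auto simp: factor_def intro: I_r_closed)

text \<open>An ideal is closed under multiples, so a face with weight in \<open>J\<close> forces every coface to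
  have weight in \<open>J\<close>; removing \<open>w\<^sup>-\<^sup>1(J)\<close> therefore leaves a downward closed set.\<close>

lemma subcomplex_Diff_weight_preimage:
  assumes "weighted_simplicial_complex R K w" and "ideal J R"
  shows "subcomplex (K - weight_preimage K w J) K"
proof -
  have K: "abstract_simplicial_complex K"
    using assms(1) by (simp add: weighted_simplicial_complex_def)
  have dvd: "w \<tau> divides\<^bsub>R\<^esub> w \<sigma>" if "\<tau> \<in> K" "\<sigma> \<in> K" "\<tau> \<subseteq> \<sigma>" for \<tau> \<sigma>
    using assms(1) that by (simp add: weighted_simplicial_complex_def)
  have "w \<tau> \<notin> J" if "\<sigma> \<in> K" "w \<sigma> \<notin> J" "\<tau> \<in> K" "\<tau> \<subseteq> \<sigma>" for \<sigma> \<tau>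
    using ideal.divides_mem[OF assms(2) _ dvd[OF that(3,1,4)]] that(2) by metis
  with K show ?thesis
    unfolding subcomplex_def abstract_simplicial_complex_def weight_preimage_def by blast
qed

theorem theorem4p1:
  fixes R :: "('r, 'm) ring_scheme"
    and I :: "nat \<Rightarrow> 'r set"
    and K :: "'v set set"
    and w :: "'v set \<Rightarrow> 'r"
    and L :: "nat \<Rightarrow> 'v set set"
  assumes "cring R"
    and "\<And>i. ideal (I i) R"
    and "I 0 = carrier R"
    and "\<And>i. I (Suc i) \<subseteq> I i"
    and "weighted_simplicial_complex R K w"
    and "\<And>\<sigma>. \<sigma> \<in> K \<Longrightarrow> w \<sigma> \<noteq> \<zero>\<^bsub>R\<^esub>"
    and "\<And>i. L i = K - weight_preimage K w (I i)"
  shows "filtration K L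
    \<and> L 0 = {}
    \<and> (\<forall>i. L i \<subseteq> K - weight_preimage K w {\<zero>\<^bsub>R\<^esub>})
    \<and> K - weight_preimage K w {\<zero>\<^bsub>R\<^esub>} = K"
proof -
  have "subcomplex (L i) K" for i
    using subcomplex_Diff_weight_preimage[OF assms(5) assms(2)] assms(7) by simp
  \<comment> \<open>The chain of ideals descends, so passing to the next ideal removes fewer
    simplices: complementation reverses the inclusion.\<close>
  moreover have "L i \<subseteq> L (Suc i)" for i
    using assms(4)[of i] by (auto simp: assms(7) weight_preimage_def)
  \<comment> \<open>Since \<open>w\<close> maps \<open>K\<close> into the carrier, which is
    \<open>I 0\<close>, every simplex is removed at stage 0.\<close>
  moreover have "L 0 = {}"
    using assms(5) unfolding weighted_simplicial_complex_def assms(3,7) weight_preimage_def by blast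
  \<comment> \<open>Weights on \<open>K\<close> are nonzero, so the preimage of the zero ideal is
    empty.\<close>
  moreover have "K - weight_preimage K w {\<zero>\<^bsub>R\<^esub>} = K"
    using assms(6) by (auto simp: weight_preimage_def)
  moreover have "L i \<subseteq> K" for i
    unfolding assms(7) by (rule Diff_subset)
  ultimately show ?thesis
    unfolding filtration_def by simp
qed

end
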